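(* Let $K_6$ be the complete graph on the vertex set $\mathcal{V}=\{A,B,C,D,E,F\}$. Let $\mathcal{B}$ be the set of the $10$ bisections of $K_6$, i.e. the unordered partitions of $\mathcal{V}$ into two $3$-element subsets (two disjoint triangles). For an edge $uv$ of $K_6$, let $e(u,v)\subseteq\mathcal{B}$ be the set of bisections in which $u$ and $v$ lie in the same triangle; $|e(u,v)|=4$. Let $\mathcal{F}$ be the set of the six $1$-factorizations of $K_6$ (partitions of the edge set of $K_6$ into five perfect matchings). For a perfect matching $m$ of $K_6$, let $\underline{m}\subseteq\mathcal{B}$ be the set of bisections not belonging to $e(u,v)$ for any edge $uv$ of $m$ (so $|\underline{m}|=4$). Any two distinct $1$-factorizations $f,g\in\mathcal{F}$ have exactly one perfect matching in common, denoted $m(f,g)$. Define three families of $6$-element subsets of the $22$-element set $\mathcal{V}\cup\mathcal{B}\cup\mathcal{F}$: (i) $\widetilde{\mathcal{E}}=\{\{u,v\}\cup e(u,v) : u,v\in\mathcal{V},\ u\neq v\}\cup\{\mathcal{V}\}$; (ii) $\widetilde{\mathcal{M}}=\{\{f,g\}\cup \underline{m(f,g)} : f,g\in\mathcal{F},\ f\neq g\}\cup\{\mathcal{F}\}$; (iii) $\mathcal{EM}$: for each pair $(e,m)$ where $e=vv'$ is an edge of $K_6$ and $m$ is a perfect matching of $K_6$ containing $e$, with $f,f'\in\mathcal{F}$ the two $1$-factorizations whose common matching is $m$, the block $\{v,v',f,f'\}\cup\big(\mathcal{B}\setminus(e(v,v')\cup\underline{m})\big)$. Then $(\mathcal{V}\cup\mathcal{B}\cup\mathcal{F},\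 \widetilde{\mathcal{E}}\cup\widetilde{\mathcal{M}}\cup\mathcal{EM})$ is a $3$-$(22,6,1)$ design, i.e. every $3$-element subset of the $22$ points is contained in exactly one of these blocks.
   Context: A $t$-$(v,k,\lambda)$ design is a pair $(\mathbb{V},\mathbb{B})$ where $\mathbb{V}$ is a set of $v$ points and $\mathbb{B}$ is a collection of $k$-element subsets of $\mathbb{V}$ (blocks) such that every $t$-element subset of $\mathbb{V}$ is contained in exactly $\lambda$ blocks. A perfect matching of $K_6$ is a set of three pairwise disjoint edges; $K_6$ has $15$ perfect matchings, each contained in exactly two of its six $1$-factorizations. *)

theory Defs
  imports Main "HOL-Library.Disjoint_Sets"
begin

definition is_design ::
  "nat \<Rightarrow> nat \<Rightarrow> nat \<Rightarrow> nat \<Rightarrow> 'a set \<Rightarrow> 'a set set \<Rightarrow> bool" where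
  "is_design t v k l P Bl \<longleftrightarrow>
     finite P \<and> card P = v \<and>
     (\<forall>b\<in>Bl. b \<subseteq> P \<and> card b = k) \<and>
     (\<forall>T. T \<subseteq> P \<and> card T = t \<longrightarrow> card {b \<in> Bl. T \<subseteq> b} = l)"

datatype vertex = A | B | C | D | E | F

definition edges :: "vertex set set" where
  "edges = {{u, v} | u v. u \<noteq> v}"

definition bisections :: "vertex set set set" where
  "bisections = {b. partition_on UNIV b \<and> card b = 2 \<and> (\<forall>T\<in>b. card T = 3)}"

definition same_triangle :: "vertex \<Rightarrow> vertex \<Rightarrow> vertex set set set" where
  "same_triangle u v = {b \<in> bisections. \<exists>T\<in>b. u \<in> T \<and> v \<in> T}"

definition perfect_matching :: "vertex set set \<Rightarrow> bool" where
  "perfect_matching m \<longleftrightarrow> m \<subseteq> edges \<and> card m = 3 \<and> disjoint m"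

definition one_factorizations :: "vertex set set set set" where
  "one_factorizations =
     {f. partition_on edges f \<and> card f = 5 \<and> (\<forall>m\<in>f. perfect_matching m)}"

definition matching_bisections :: "vertex set set \<Rightarrow> vertex set set set" where
  "matching_bisections m =
     {b \<in> bisections. \<forall>u v. {u, v} \<in> m \<longrightarrow> b \<notin> same_triangle u v}"

text \<open>Two distinct 1-factorizations share exactly one perfect matching, so the
  description below is used only where it is well defined.\<close>

definition common_matching ::
  "vertex set set set \<Rightarrow> vertex set set set \<Rightarrow> vertex set set" where
  "common_matching f g = (THE m. m \<in> f \<and> m \<in> g)"

text \<open>The point set is the disjoint union of vertices, bisections and
  1-factorizations, realized inside a tagged sum type.\<close>

datatype point =
    Vertex vertex
  | Bisection "vertex set set"
  | Factorization "vertex set set set"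

definition points :: "point set" where
  "points = range Vertex \<union> Bisection ` bisections \<union> Factorization ` one_factorizations"

definition edge_blocks :: "point set set" where
  "edge_blocks =
     {{Vertex u, Vertex v} \<union> Bisection ` same_triangle u v | u v. u \<noteq> v}
     \<union> {range Vertex}"

definition matching_blocks :: "point set set" where
  "matching_blocks =
     {{Factorization f, Factorization g}
        \<union> Bisection ` matching_bisections (common_matching f g) | f g.
        f \<in> one_factorizations \<and> g \<in> one_factorizations \<and> f \<noteq> g}
     \<union> {Factorization ` one_factorizations}"

definition edge_matching_blocks :: "point set set" where
  "edge_matching_blocks =
     {{Vertex v, Vertex v', Factorization f, Factorization f'}
        \<union> Bisection ` (bisections - (same_triangle v v' \<union> matching_bisections m))
      | v v' m f f'.
        perfect_matching m \<and> {v, v'} \<in> m \<and>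
        f \<in> one_factorizations \<and> f' \<in> one_factorizations \<and> f \<noteq> f' \<and>
        common_matching f f' = m}"

end

(* Bisections correspond to the ten triangles containing A, and searching outwards from the five
   edges at A leaves exactly six 1-factorizations. Numbering these objects turns the design into
   77 blocks on 22 labels, where the covering property is a finite computation: fixing the points
   of a triple one after the other and keeping only the blocks through them leaves one block. *)

theory Submission
  imports Defs
begin

section \<open>Explicit lists of the objects of K_6\<close>

definition vertices :: "vertex list" where
  "vertices = [A, B, C, D, E, F]"

definition edge_list :: "vertex set list" where
  "edge_list =
     [{A, B}, {A, C}, {A, D}, {A, E}, {A, F}, {B, C}, {B, D}, {B, E}, {B, F},
      {C, D}, {C, E}, {C, F}, {D, E}, {D, F}, {E, F}]"

definition triangles :: "vertex set list" where
  "triangles =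
     [{A, B, C}, {A, B, D}, {A, B, E}, {A, B, F}, {A, C, D}, 
      {A, C, E}, {A, C, F}, {A, D, E}, {A, D, F}, {A, E, F}]"

definition matchings :: "vertex set set list" where
  "matchings =
     [{{A, B}, {C, D}, {E, F}}, {{A, B}, {C, E}, {D, F}}, {{A, B}, {C, F}, {D, E}},
      {{A, C}, {B, D}, {E, F}}, {{A, C}, {B, E}, {D, F}}, {{A, C}, {B, F}, {D, E}},
      {{A, D}, {B, C}, {E, F}}, {{A, D}, {B, E}, {C, F}}, {{A, D}, {B, F}, {C, E}},
      {{A, E}, {B, C}, {D, F}}, {{A, E}, {B, D}, {C, F}}, {{A, E}, {B, F}, {C, D}},
      {{A, F}, {B, C}, {D, E}}, {{A, F}, {B, D}, {C, E}}, {{A, F}, {B, E}, {C, D}}]"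

text \<open>Within each entry the five matchings are ordered by the partner of \<open>A\<close>,
  from \<open>B\<close> to \<open>F\<close>. Each of the three matchings through
  \<open>{A, B}\<close> starts exactly two entries.\<close>

definition factorizations :: "vertex set set set list" where
  "factorizations =
     [{{{A, B}, {C, D}, {E, F}},
      {{A, C}, {B, E}, {D, F}},
      {{A, D}, {B, F}, {C, E}},
      {{A, E}, {B, D}, {C, F}},
      {{A, F}, {B, C}, {D, E}}},
     {{{A, B}, {C, D}, {E, F}},
      {{A, C}, {B, F}, {D, E}},
      {{A, D}, {B, E}, {C, F}},
      {{A, E}, {B, C}, {D, F}},
      {{A, F}, {B, D}, {C, E}}},
     {{{A, B}, {C, E}, {D, F}},
      {{A, C}, {B, D}, {E, F}},
      {{A, D}, {B, E}, {C, F}},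
      {{A, E}, {B, F}, {C, D}},
      {{A, F}, {B, C}, {D, E}}},
     {{{A, B}, {C, E}, {D, F}},
      {{A, C}, {B, F}, {D, E}},
      {{A, D}, {B, C}, {E, F}},
      {{A, E}, {B, D}, {C, F}},
      {{A, F}, {B, E}, {C, D}}},
     {{{A, B}, {C, F}, {D, E}},
      {{A, C}, {B, D}, {E, F}},
      {{A, D}, {B, F}, {C, E}},
      {{A, E}, {B, C}, {D, F}},
      {{A, F}, {B, E}, {C, D}}},
     {{{A, B}, {C, F}, {D, E}},
      {{A, C}, {B, E}, {D, F}},
      {{A, D}, {B, C}, {E, F}},
      {{A, E}, {B, F}, {C, D}},
      {{A, F}, {B, D}, {C, E}}}]"

section \<open>Edges, triangles, matchings and 1-factorizations by exhaustive search\<close>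

lemma UNIV_vertex: "UNIV = {A, B, C, D, E, F}"
  using vertex.exhaust by auto

lemma finite_vertex [simp]: "finite (S :: vertex set)"
proof (rule finite_subset)
  show "S \<subseteq> {A, B, C, D, E, F}"
    unfolding UNIV_vertex[symmetric] by (rule subset_UNIV)
qed simp

lemma card_UNIV_vertex: "card (UNIV :: vertex set) = 6"
  by (simp add: UNIV_vertex)

lemma set_vertices [simp]: "set vertices = UNIV"
  by (auto simp: UNIV_vertex vertices_def)

lemma edges_eq: "edges = set edge_list"
proof -
  have "\<forall>u\<in>set vertices. \<forall>v\<in>set vertices. u \<noteq> v \<longrightarrow> {u, v} \<in> set edge_list"
    by code_simp
  moreover have "\<forall>e\<in>set edge_list. \<exists>u\<in>set vertices. \<exists>v\<in>set vertices. e = {u, v} \<and> u \<noteq> v"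
    by code_simp
  ultimately show ?thesis
    unfolding edges_def by auto
qed

lemma triangle_iff: "A \<in> S \<and> card S = 3 \<longleftrightarrow> S \<in> set triangles"
proof -
  have "\<forall>S\<in>Pow (set vertices). A \<in> S \<and> card S = 3 \<longleftrightarrow> S \<in> set triangles"
    by code_simp
  then show ?thesis by simp
qed

lemma perfect_matching_iff: "perfect_matching m \<longleftrightarrow> m \<in> set matchings"
proof
  assume "perfect_matching m"
  then have sub: "m \<subseteq> set edge_list" and "card m = 3" and disj: "disjoint m"
    by (auto simp: perfect_matching_def edges_eq)
  then obtain x y z where m: "m = {x, y, z}" "x \<noteq> y" "x \<noteq> z" "y \<noteq> z"
    by (auto simp: card_3_iff)
  \<comment> \<open>Disjointness is tested before the next edge is chosen. Written as disjunctions,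
    the tests cut off a branch as soon as two edges meet, since evaluation stops at a true left
    side.\<close>
  have "\<forall>x\<in>set edge_list. \<forall>y\<in>set edge_list. x \<inter> y = {} \<longrightarrow>
          (\<forall>z\<in>set edge_list. x \<inter> z = {} \<longrightarrow> y \<inter> z = {} \<longrightarrow> {x, y, z} \<in> set matchings)"
    unfolding imp_conv_disj by code_simp
  moreover have "x \<inter> y = {}" "x \<inter> z = {}" "y \<inter> z = {}"
    using disj m by (auto simp: disjoint_def)
  ultimately show "m \<in> set matchings"
    using sub m by auto
next
  have check: "\<forall>m\<in>set matchings. (\<forall>e\<in>m. e \<in> set edge_list) \<and> card m = 3 \<and>
          (\<forall>x\<in>m. \<forall>y\<in>m. x \<noteq> y \<longrightarrow> x \<inter> y = {})"
    by code_simp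
  assume "m \<in> set matchings"
  from bspec[OF check this] show "perfect_matching m"
    by (simp add: perfect_matching_def disjoint_def edges_eq subset_iff)
qed

lemma one_factorizations_eq: "one_factorizations = set factorizations"
proof
  show "set factorizations \<subseteq> one_factorizations"
  proof
    fix f
    assume f: "f \<in> set factorizations"
    have check: "\<forall>f\<in>set factorizations. card f = 5 \<and> {} \<notin> f \<and> \<Union> f = set edge_list \<and>
            (\<forall>m\<in>f. m \<in> set matchings) \<and> (\<forall>x\<in>f. \<forall>y\<in>f. x \<noteq> y \<longrightarrow> x \<inter> y = {})"
      by code_simp
    from bspec[OF check f] show "f \<in> one_factorizations"
      by (simp add: one_factorizations_def partition_on_def perfect_matching_iff edges_eq
          disjoint_def)
  qed
next
  let ?star = "\<lambda>x. {m \<in> set matchings. {A, x} \<in> m}"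
  \<comment> \<open>Allowing \<open>m = n\<close> makes \<open>?ok\<close> hold for any two members
    of a 1-factorization, with no prior proof that they differ. It costs nothing: a matching gives
    \<open>A\<close> only one partner, so different stars share no matching.\<close>
  let ?ok = "\<lambda>m n. m = n \<or> m \<inter> n = {}"
  have search: "\<forall>a\<in>?star B. \<forall>b\<in>?star C. ?ok a b \<longrightarrow>
          (\<forall>c\<in>?star D. ?ok a c \<longrightarrow> ?ok b c \<longrightarrow>
          (\<forall>d\<in>?star E. ?ok a d \<longrightarrow> ?ok b d \<longrightarrow> ?ok c d \<longrightarrow>
          (\<forall>e\<in>?star F. ?ok a e \<longrightarrow> ?ok b e \<longrightarrow> ?ok c e \<longrightarrow> ?ok d e \<longrightarrow>
             card {a, b, c, d, e} = 5 \<and> {a, b, c, d, e} \<in> set factorizations)))"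
    unfolding imp_conv_disj by code_simp
  show "one_factorizations \<subseteq> set factorizations"
  proof
    fix f
    assume "f \<in> one_factorizations"
    then have part: "partition_on edges f" and card: "card f = 5"
      and match: "\<forall>m\<in>f. m \<in> set matchings"
      by (auto simp: one_factorizations_def perfect_matching_iff)
    have ok: "?ok m n" if "m \<in> f" "n \<in> f" for m n
      using that partition_onD2[OF part] by (auto simp: disjoint_def)
    have star: "\<exists>m. m \<in> f \<and> m \<in> ?star x" if "x \<noteq> A" for x
    proof -
      have "{A, x} \<in> edges"
        using that unfolding edges_def by blast
      then show ?thesis
        using partition_onD1[OF part] match by blast
    qed
    obtain a b c d e where f: "a \<in> f" "b \<in> f" "c \<in> f" "d \<in> f" "e \<in> f"
      and st: "a \<in> ?star B" "b \<in> ?star C" "c \<in> ?star D" "d \<in> ?star E" "e \<in> ?star F"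
      using star[of B] star[of C] star[of D] star[of E] star[of F] by auto
    \<comment> \<open>The facts follow the order of \<open>search\<close>: each chosen matching
      comes with its compatibility with all earlier ones.\<close>
    have "card {a, b, c, d, e} = 5 \<and> {a, b, c, d, e} \<in> set factorizations"
      using search[rule_format, OF st(1,2) ok st(3) ok ok st(4) ok ok ok st(5) ok ok ok ok] f
      by blast
    \<comment> \<open>The five chosen matchings are distinct and \<open>f\<close> has only five
      elements, so they exhaust \<open>f\<close>.\<close>
    moreover have "finite f"
      using card by (simp add: card_ge_0_finite)
    ultimately show "f \<in> set factorizations"
      using f card card_subset_eq[of f "{a, b, c, d, e}"] by auto
  qed
qed

section \<open>Bisections represented by triangles through \<open>A\<close>\<close>

definition bisection :: "vertex set \<Rightarrow> vertex set set" where
  "bisection S = {S, - S}"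

text \<open>One of the two parts contains \<open>A\<close>, and the other is its complement, so that
  part alone recovers the bisection. Conversely, a complement of three among six vertices again has
  three elements.\<close>

lemma bisections_eq: "bisections = bisection ` set triangles"
proof
  show "bisections \<subseteq> bisection ` set triangles"
  proof
    fix b
    assume "b \<in> bisections"
    then have part: "partition_on UNIV b" and two: "card b = 2" and three: "\<forall>S\<in>b. card S = 3"
      by (auto simp: bisections_def)
    obtain S where S: "S \<in> b" "A \<in> S"
      using partition_onD1[OF part] by blast
    obtain S' where b: "b = {S, S'}" "S \<noteq> S'"
      using two S(1) unfolding card_2_iff by (metis insert_commute insertE singletonD)
    have "S \<inter> S' = {}" "S \<union> S' = UNIV"
      using b partition_onD2[OF part] partition_onD1[OF part] by (auto simp: disjoint_def)
    then have "b = bisection S"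
      using b by (auto simp: bisection_def)
    then show "b \<in> bisection ` set triangles"
      using S three triangle_iff by blast
  qed
next
  show "bisection ` set triangles \<subseteq> bisections"
  proof
    fix b
    assume "b \<in> bisection ` set triangles"
    then obtain S where S: "A \<in> S" "card S = 3" and b: "b = {S, - S}"
      using triangle_iff by (auto simp: bisection_def)
    have "card (- S) = 3"
      using S by (simp add: Compl_eq_Diff_UNIV card_Diff_subset card_UNIV_vertex)
    moreover from this have "- S \<noteq> {}" by auto
    ultimately show "b \<in> bisections"
      using S b by (auto simp: bisections_def partition_on_def disjoint_def card_insert_if)
  qed
qed

text \<open>Equal pairs force \<open>S = S'\<close> or \<open>S = - S'\<close>, and the latter fails
  because both triangles contain \<open>A\<close>.\<close>

lemma inj_on_bisection: "inj_on bisection (set triangles)"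
proof (rule inj_onI)
  fix S S'
  assume "S \<in> set triangles" "S' \<in> set triangles" "bisection S = bisection S'"
  moreover from this have "A \<in> S" "A \<in> S'"
    using triangle_iff by blast+
  ultimately show "S = S'"
    by (auto simp: bisection_def doubleton_eq_iff)
qed

text \<open>Two vertices share a part when both lie in \<open>S\<close> or both lie outside it.
  Hence complements need not appear in the computations.\<close>

lemma same_triangle_eq:
  "same_triangle u v = bisection ` {S \<in> set triangles. u \<in> S \<longleftrightarrow> v \<in> S}"
proof -
  have "(\<exists>S'\<in>bisection S. u \<in> S' \<and> v \<in> S') \<longleftrightarrow> (u \<in> S \<longleftrightarrow> v \<in> S)" for S
    by (auto simp: bisection_def)
  then show ?thesis
    unfolding same_triangle_def bisections_eq by blast
qed

text \<open>An edge is separated by the bisection exactly when it meets \<open>S\<close> without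
  lying inside it. Quantifying over the members of \<open>m\<close> as whole sets gives an
  executable test; it is faithful because they are all doubletons \<open>{u, v}\<close>.\<close>

lemma matching_bisections_eq:
  assumes "perfect_matching m"
  shows "matching_bisections m =
    bisection ` {S \<in> set triangles. \<forall>e\<in>m. \<not> e \<subseteq> S \<and> e \<inter> S \<noteq> {}}"
proof -
  \<comment> \<open>Injectivity of \<open>bisection\<close> turns membership of
    \<open>bisection S\<close> back into a condition on \<open>S\<close> itself.\<close>
  have same: "bisection S \<in> same_triangle u v \<longleftrightarrow> (u \<in> S \<longleftrightarrow> v \<in> S)"
    if "S \<in> set triangles" for S u v
    using that inj_on_bisection by (auto simp: same_triangle_eq inj_on_def)
  have edge: "\<exists>u v. e = {u, v}" if "e \<in> m" for e
    using assms that unfolding perfect_matching_def edges_def by blast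
  have "(\<forall>u v. {u, v} \<in> m \<longrightarrow> bisection S \<notin> same_triangle u v) \<longleftrightarrow>
        (\<forall>e\<in>m. \<not> e \<subseteq> S \<and> e \<inter> S \<noteq> {})" if "S \<in> set triangles" for S
  proof -
    have "(u \<in> S \<longleftrightarrow> v \<notin> S) \<longleftrightarrow> \<not> {u, v} \<subseteq> S \<and> {u, v} \<inter> S \<noteq> {}" for u v
      by blast
    then show ?thesis
      using same[OF that] edge by metis
  qed
  then show ?thesis
    unfolding matching_bisections_def bisections_eq by blast
qed

section \<open>Labels for the points and the list of blocks\<close>

datatype label = V vertex | T nat | W nat

text \<open>With labels, the covering check compares vertices and small numbers rather than deeply
  nested sets.\<close>

fun decode :: "label \<Rightarrow> point" where
  "decode (V u) = Vertex u"
| "decode (T i) = Bisection (bisection (triangles ! i))"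
| "decode (W i) = Factorization (factorizations ! i)"

definition labels :: "label list" where
  "labels = map V vertices @ map T [0..<10] @ map W [0..<6]"

definition edge_labels :: "vertex \<Rightarrow> vertex \<Rightarrow> nat list" where
  "edge_labels u v = filter (\<lambda>i. u \<in> triangles ! i \<longleftrightarrow> v \<in> triangles ! i) [0..<10]"

text \<open>An executable replacement for the definite description in
  \<open>common_matching\<close>, meaningful for distinct indices below 6.\<close>

definition shared_matching :: "nat \<Rightarrow> nat \<Rightarrow> vertex set set" where
  "shared_matching i j = the_elem (factorizations ! i \<inter> factorizations ! j)"

definition matching_labels :: "vertex set set \<Rightarrow> nat list" where
  "matching_labels m =
     filter (\<lambda>i. \<forall>e\<in>m. \<not> e \<subseteq> triangles ! i \<and> e \<inter> triangles ! i \<noteq> {}) [0..<10]"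

text \<open>One orientation of each edge is enough, because the blocks are symmetric in the two
  endpoints.\<close>

definition vertex_pairs :: "(vertex \<times> vertex) list" where
  "vertex_pairs =
     [(A, B), (A, C), (A, D), (A, E), (A, F), (B, C), (B, D), (B, E), (B, F),
      (C, D), (C, E), (C, F), (D, E), (D, F), (E, F)]"

definition index_pairs :: "(nat \<times> nat) list" where
  "index_pairs = [(i, j). i \<leftarrow> [0..<6], j \<leftarrow> [0..<6], i < j]"

text \<open>The functions below are passed to \<^const>\<open>map\<close> unapplied: under a binder, rewriting
  would unfold their bodies symbolically before the arguments are known.\<close>

fun edge_block :: "vertex \<times> vertex \<Rightarrow> label set" where
  "edge_block (u, v) = {V u, V v} \<union> T ` set (edge_labels u v)"

fun matching_block :: "nat \<times> nat \<Rightarrow> label set" where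
  "matching_block (i, j) = {W i, W j} \<union> T ` set (matching_labels (shared_matching i j))"

fun edge_matching_block :: "nat \<Rightarrow> nat \<Rightarrow> nat list \<Rightarrow> vertex \<times> vertex \<Rightarrow> label set" where
  "edge_matching_block i j ks (u, v) =
     {V u, V v, W i, W j} \<union> T ` (set [0..<10] - (set (edge_labels u v) \<union> set ks))"

definition edges_of_matching_blocks :: "nat \<Rightarrow> nat \<Rightarrow> vertex set set \<Rightarrow> label set list" where
  "edges_of_matching_blocks i j m =
     map (edge_matching_block i j (matching_labels m)) (filter (\<lambda>(u, v). {u, v} \<in> m) vertex_pairs)"

fun edge_shared_matching_blocks :: "nat \<times> nat \<Rightarrow> label set list" where
  "edge_shared_matching_blocks (i, j) = edges_of_matching_blocks i j (shared_matching i j)"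

text \<open>The length is 2 + 15 + 15 + 45 = 77: two exceptional blocks, fifteen edges, fifteen
  pairs of 1-factorizations, and the three edges of the matching shared by each such pair.\<close>

definition label_blocks :: "label set list" where
  "label_blocks =
     [V ` set vertices, W ` set [0..<6]] @ map edge_block vertex_pairs @
     map matching_block index_pairs @ concat (map edge_shared_matching_blocks index_pairs)"

section \<open>Correspondence between labels and points\<close>

lemma length_triangles: "length triangles = 10"
  by code_simp

lemma length_factorizations: "length factorizations = 6"
  by code_simp

lemma set_triangles: "set triangles = (!) triangles ` {0..<10}"
  by (auto simp: set_conv_nth length_triangles image_iff)

lemma set_factorizations: "set factorizations = (!) factorizations ` {0..<6}"
  by (auto simp: set_conv_nth length_factorizations image_iff)

lemma inj_on_triangle_bisection: "inj_on (\<lambda>i. bisection (triangles ! i)) {0..<10}"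
proof -
  have "distinct triangles"
    by code_simp
  then have "inj_on ((!) triangles) {0..<10}"
    by (auto simp: inj_on_def nth_eq_iff_index_eq length_triangles)
  then have "inj_on (bisection \<circ> (!) triangles) {0..<10}"
    using inj_on_bisection by (intro comp_inj_on) (auto simp: set_triangles)
  then show ?thesis
    by (simp add: comp_def)
qed

lemma inj_on_factorizations: "inj_on ((!) factorizations) {0..<6}"
proof -
  have "distinct factorizations"
    by code_simp
  then show ?thesis
    by (auto simp: inj_on_def nth_eq_iff_index_eq length_factorizations)
qed

lemma in_labels:
  "V u \<in> set labels" "T i \<in> set labels \<longleftrightarrow> i < 10" "W i \<in> set labels \<longleftrightarrow> i < 6"
  by (auto simp: labels_def)

text \<open>Lookups past the end of a list are unspecified, hence the restriction to
  \<open>labels\<close>. This injectivity is what carries cardinalities and inclusions from labels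
  over to points.\<close>

lemma inj_on_decode: "inj_on decode (set labels)"
proof (rule inj_onI)
  fix x y
  assume "x \<in> set labels" "y \<in> set labels" "decode x = decode y"
  then show "x = y"
    by - (cases x; cases y; simp add: in_labels inj_on_eq_iff[OF inj_on_triangle_bisection]
        inj_on_eq_iff[OF inj_on_factorizations])
qed

lemma points_eq: "points = decode ` set labels"
  by (simp add: points_def labels_def bisections_eq one_factorizations_eq set_triangles
      set_factorizations image_Un image_image Un_assoc)

lemma bisections_nth: "bisections = (\<lambda>i. bisection (triangles ! i)) ` {0..<10}"
  by (simp add: bisections_eq set_triangles image_image)

lemma same_triangle_nth:
  "same_triangle u v = (\<lambda>i. bisection (triangles ! i)) ` set (edge_labels u v)"
  by (auto simp: same_triangle_eq set_triangles edge_labels_def)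

lemma matching_bisections_nth:
  assumes "perfect_matching m"
  shows "matching_bisections m = (\<lambda>i. bisection (triangles ! i)) ` set (matching_labels m)"
  unfolding matching_bisections_eq[OF assms] set_triangles matching_labels_def
  by auto

text \<open>By computation, two distinct entries of \<open>factorizations\<close> meet in a single
  matching, so the description in \<open>common_matching\<close> is well defined and agrees with
  \<open>the_elem\<close>.\<close>

lemma shared_matching:
  assumes "i < 6" "j < 6" "i \<noteq> j"
  shows "common_matching (factorizations ! i) (factorizations ! j) = shared_matching i j"
    and "perfect_matching (shared_matching i j)"
proof -
  \<comment> \<open>The first disjunct excludes the diagonal, where the intersection has five
    elements.\<close>
  have "\<forall>i\<in>set [0..<6]. \<forall>j\<in>set [0..<6]. i = j \<or>
      card (factorizations ! i \<inter> factorizations ! j) = 1 \<and> shared_matching i j \<in> set matchings"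
    by code_simp
  then have one: "card (factorizations ! i \<inter> factorizations ! j) = 1"
    and mem: "shared_matching i j \<in> set matchings"
    using assms by (metis atLeastLessThan_iff set_upt zero_le)+
  then obtain m where m: "factorizations ! i \<inter> factorizations ! j = {m}"
    by (auto simp: card_1_singleton_iff)
  then have "x \<in> factorizations ! i \<and> x \<in> factorizations ! j \<longleftrightarrow> x = m" for x
    unfolding set_eq_iff Int_iff singleton_iff by simp
  then have "common_matching (factorizations ! i) (factorizations ! j) = m"
    by (simp add: common_matching_def)
  then show "common_matching (factorizations ! i) (factorizations ! j) = shared_matching i j"
    using m by (simp add: shared_matching_def)
  show "perfect_matching (shared_matching i j)"
    using mem by (simp add: perfect_matching_iff)
qed

section \<open>A recursive test for unique covering\<close>

fun unique_cover :: "nat \<Rightarrow> 'a set list \<Rightarrow> 'a list \<Rightarrow> bool" where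
  "unique_cover 0 bs xs \<longleftrightarrow> card (set bs) = 1"
| "unique_cover (Suc t) bs [] \<longleftrightarrow> True"
| "unique_cover (Suc t) bs (x # xs) \<longleftrightarrow>
     unique_cover t (filter (\<lambda>b. x \<in> b) bs) xs \<and> unique_cover (Suc t) bs xs"

text \<open>A subset of size \<open>Suc t\<close> of \<open>x # xs\<close> either contains
  \<open>x\<close>, and its other \<open>t\<close> points are sought in \<open>xs\<close> among the
  blocks through \<open>x\<close>, or it lies in \<open>xs\<close> already. A list that runs out
  while points remain to be chosen has no such subset, hence the value \<open>True\<close>
  there.\<close>

lemma unique_coverD:
  assumes "unique_cover t bs xs" "S \<subseteq> set xs" "card S = t"
  shows "card {b \<in> set bs. S \<subseteq> b} = 1"
  using assms
proof (induction t bs xs arbitrary: S rule: unique_cover.induct)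
  case (1 bs xs)
  then have "S = {}"
    \<comment> \<open>Finiteness matters here, since an infinite set also has cardinality 0.\<close>
    using finite_subset by fastforce
  with 1 show ?case by simp
next
  case (2 t bs)
  then show ?case by simp
next
  case (3 t bs x xs)
  show ?case
  proof (cases "x \<in> S")
    case True
    have "finite S"
      using "3.prems"(2) finite_subset by blast
    then have "card (S - {x}) = t"
      using True "3.prems"(3) by simp
    then have "card {b \<in> set (filter (\<lambda>b. x \<in> b) bs). S - {x} \<subseteq> b} = 1"
      using "3.prems" by (intro "3.IH"(1)) auto
    moreover have "{b \<in> set (filter (\<lambda>b. x \<in> b) bs). S - {x} \<subseteq> b} = {b \<in> set bs. S \<subseteq> b}"
      using True by auto
    ultimately show ?thesis by simp
  next
    case False
    then show ?thesis
      using "3.prems" by (intro "3.IH"(2)) auto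
  qed
qed

section \<open>The three block families in terms of labels\<close>

lemma Collect_pairs_cong:
  assumes "\<And>x y. R x y \<Longrightarrow> P x y = Q x y"
  shows "{P x y | x y. R x y} = {Q x y | x y. R x y}"
  using assms by force

text \<open>A family symmetric in its two parameters is exhausted by one orientation of each pair.
  This serves pairs of vertices, pairs of 1-factorizations and the edges of a matching
  alike.\<close>

lemma symmetric_pairs_image:
  assumes "\<And>x y. R x y \<Longrightarrow> P x y = P y x" "\<And>x y. R x y \<longleftrightarrow> (x, y) \<in> Q \<or> (y, x) \<in> Q"
  shows "{P x y | x y. R x y} = (\<lambda>(x, y). P x y) ` Q"
proof -
  have "P x y \<in> (\<lambda>(x, y). P x y) ` Q" if "R x y" for x y
    using that assms(1)[OF that] unfolding assms(2) by force
  then show ?thesis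
    using assms(2) by auto
qed

lemma vertex_pairs_iff: "u \<noteq> v \<longleftrightarrow> (u, v) \<in> set vertex_pairs \<or> (v, u) \<in> set vertex_pairs"
proof -
  have "\<forall>u\<in>set vertices. \<forall>v\<in>set vertices.
      u \<noteq> v \<longleftrightarrow> (u, v) \<in> set vertex_pairs \<or> (v, u) \<in> set vertex_pairs"
    by code_simp
  then show ?thesis by simp
qed

lemma set_index_pairs: "set index_pairs = {(i, j). i < j \<and> j < 6}"
  by (auto simp: index_pairs_def)

lemma index_pairs_iff:
  "i < 6 \<and> j < 6 \<and> i \<noteq> j \<longleftrightarrow> (i, j) \<in> set index_pairs \<or> (j, i) \<in> set index_pairs"
  by (auto simp: set_index_pairs)

lemma shared_matching_commute: "shared_matching i j = shared_matching j i"
  by (simp add: shared_matching_def Int_commute)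

lemma edge_labels_commute: "edge_labels u v = edge_labels v u"
  unfolding edge_labels_def by metis

lemma edge_blocks_eq:
  "edge_blocks = (`) decode ` ({V ` set vertices} \<union> edge_block ` set vertex_pairs)"
proof -
  have eb: "{Vertex u, Vertex v} \<union> Bisection ` same_triangle u v = decode ` edge_block (u, v)"
    for u v
    by (simp add: same_triangle_nth image_Un image_image)
  have "edge_block (u, v) = edge_block (v, u)" for u v
    by (auto simp: edge_labels_commute[of u v])
  then have "{decode ` edge_block (u, v) | u v. u \<noteq> v} =
      (\<lambda>(u, v). decode ` edge_block (u, v)) ` set vertex_pairs"
    by (intro symmetric_pairs_image vertex_pairs_iff) simp
  then show ?thesis
    unfolding edge_blocks_def eb
    by (simp add: image_Un image_image case_prod_unfold del: edge_block.simps)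
qed

text \<open>The list has no repetitions, so \<open>f \<noteq> g\<close> becomes
  \<open>i \<noteq> j\<close>. Leaving \<open>P\<close> arbitrary covers both families that involve
  pairs of 1-factorizations.\<close>

lemma factorization_pairs:
  "{P f g | f g. f \<in> one_factorizations \<and> g \<in> one_factorizations \<and> f \<noteq> g} =
   {P (factorizations ! i) (factorizations ! j) | i j. i < 6 \<and> j < 6 \<and> i \<noteq> j}"
  (is "?L = ?R")
proof
  show "?L \<subseteq> ?R"
    unfolding one_factorizations_eq set_factorizations by fastforce
  show "?R \<subseteq> ?L"
    using inj_on_factorizations
    unfolding one_factorizations_eq set_factorizations inj_on_def by fastforce
qed

lemma matching_blocks_eq:
  "matching_blocks = (`) decode ` ({W ` set [0..<6]} \<union> matching_block ` set index_pairs)"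
proof -
  have mb: "{Factorization (factorizations ! i), Factorization (factorizations ! j)} \<union>
      Bisection ` matching_bisections (common_matching (factorizations ! i) (factorizations ! j))
      = decode ` matching_block (i, j)" if "i < 6 \<and> j < 6 \<and> i \<noteq> j" for i j
    using that by (simp add: shared_matching matching_bisections_nth image_Un image_image)
  have "matching_block (i, j) = matching_block (j, i)" for i j
    by (auto simp: shared_matching_commute[of i j])
  then have "{decode ` matching_block (i, j) | i j. i < 6 \<and> j < 6 \<and> i \<noteq> j} =
      (\<lambda>(i, j). decode ` matching_block (i, j)) ` set index_pairs"
    by (intro symmetric_pairs_image index_pairs_iff) simp
  \<comment> \<open>Since \<open>mb\<close> requires distinct indices in range, the rewriting takes
    place under the condition of the comprehension.\<close>
  moreover have "{{Factorization (factorizations ! i), Factorization (factorizations ! j)} \<union>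
      Bisection ` matching_bisections (common_matching (factorizations ! i) (factorizations ! j))
      | i j. i < 6 \<and> j < 6 \<and> i \<noteq> j} = {decode ` matching_block (i, j) | i j. i < 6 \<and> j < 6 \<and> i \<noteq> j}"
    by (rule Collect_pairs_cong[OF mb])
  ultimately show ?thesis
    unfolding matching_blocks_def factorization_pairs
    by (simp add: image_Un image_image case_prod_unfold one_factorizations_eq set_factorizations
        del: matching_block.simps)
qed

text \<open>The family is regrouped as a union over pairs of 1-factorizations, each contributing the
  edges of its common matching. Both the pair and the edge are unordered, so the passage to one
  orientation happens twice.\<close>

lemma edge_matching_blocks_eq:
  "edge_matching_blocks =
     (`) decode ` (\<Union>p\<in>set index_pairs. set (edge_shared_matching_blocks p))"
proof -
  let ?emb = "\<lambda>i j. edge_matching_block i j (matching_labels (shared_matching i j))"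
  let ?P = "\<lambda>f f'. {{Vertex v, Vertex v', Factorization f, Factorization f'} \<union>
      Bisection ` (bisections - (same_triangle v v' \<union> matching_bisections (common_matching f f')))
      | v v'. perfect_matching (common_matching f f') \<and> {v, v'} \<in> common_matching f f'}"
  let ?Q = "\<lambda>i j. (`) decode ` set (edge_shared_matching_blocks (i, j))"
  have emb: "{Vertex u, Vertex v, Factorization (factorizations ! i),
        Factorization (factorizations ! j)} \<union>
      Bisection ` (bisections - (same_triangle u v \<union> matching_bisections (shared_matching i j)))
      = decode ` ?emb i j (u, v)" if "i < 6" "j < 6" "i \<noteq> j" for u v i j
  proof -
    \<comment> \<open>Complements among bisections become complements among the indices below 10,
      because the numbering is injective.\<close>
    have "bisections - (same_triangle u v \<union> matching_bisections (shared_matching i j)) =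
        (\<lambda>i. bisection (triangles ! i)) `
          (set [0..<10] - (set (edge_labels u v) \<union> set (matching_labels (shared_matching i j))))"
      unfolding bisections_nth same_triangle_nth set_upt
        matching_bisections_nth[OF shared_matching(2)[OF that]] image_Un[symmetric]
      by (intro inj_on_image_set_diff[symmetric, OF inj_on_triangle_bisection])
        (auto simp: edge_labels_def matching_labels_def)
    then show ?thesis
      by (simp add: image_Un image_image)
  qed
  have swap: "?emb i j (u, v) = ?emb i j (v, u)" for i j u v
    by (auto simp: edge_labels_commute[of u v])
  have PQ: "?P (factorizations ! i) (factorizations ! j) = ?Q i j"
    if "i < 6 \<and> j < 6 \<and> i \<noteq> j" for i j
  proof -
    have ij: "i < 6" "j < 6" "i \<noteq> j"
      using that by auto
    let ?m = "shared_matching i j"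
    have m: "perfect_matching ?m"
      using ij by (simp add: shared_matching)
    \<comment> \<open>Members of a perfect matching are genuine edges, so no degenerate
      \<open>{u, u}\<close> occurs, in agreement with \<open>vertex_pairs\<close>.\<close>
    have neq: "u \<noteq> v" if "{u, v} \<in> ?m" for u v
      using m that unfolding perfect_matching_def edges_def by (auto simp: doubleton_eq_iff)
    have "?P (factorizations ! i) (factorizations ! j) =
        {decode ` ?emb i j (u, v) | u v. {u, v} \<in> ?m}"
      unfolding shared_matching(1)[OF ij] emb[OF ij] using m by simp
    also have "\<dots> = (\<lambda>(u, v). decode ` ?emb i j (u, v)) `
        set (filter (\<lambda>(u, v). {u, v} \<in> ?m) vertex_pairs)"
    proof (rule symmetric_pairs_image)
      show "{u, v} \<in> ?m \<longleftrightarrow> (u, v) \<in> set (filter (\<lambda>(u, v). {u, v} \<in> ?m) vertex_pairs) \<or>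
          (v, u) \<in> set (filter (\<lambda>(u, v). {u, v} \<in> ?m) vertex_pairs)" for u v
        using neq vertex_pairs_iff[of u v] by (auto simp: insert_commute)
    qed (simp only: swap)
    also have "\<dots> = ?Q i j"
      by (simp add: edges_of_matching_blocks_def image_image case_prod_unfold
          del: edge_matching_block.simps)
    finally show ?thesis .
  qed
  have sym: "?Q i j = ?Q j i" for i j
  proof -
    have "edge_matching_block i j ks p = edge_matching_block j i ks p" for ks p
      by (cases p) auto
    then show ?thesis
      by (simp add: edges_of_matching_blocks_def shared_matching_commute[of i j])
  qed
  \<comment> \<open>The matching \<open>m\<close> is determined by \<open>f\<close> and
    \<open>f'\<close> and can be eliminated. An abstract \<open>K\<close> hides the shape of the
    blocks from this purely logical regrouping.\<close>
  have "{K v v' (m :: vertex set set) f f' | v v' m f f'. perfect_matching m \<and> {v, v'} \<in> m \<and>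
        f \<in> one_factorizations \<and> f' \<in> one_factorizations \<and> f \<noteq> f' \<and> common_matching f f' = m} =
      \<Union> {{K v v' (common_matching f f') f f' | v v'.
          perfect_matching (common_matching f f') \<and> {v, v'} \<in> common_matching f f'} | f f'.
        f \<in> one_factorizations \<and> f' \<in> one_factorizations \<and> f \<noteq> f'}"
    for K :: "vertex \<Rightarrow> vertex \<Rightarrow> vertex set set \<Rightarrow> vertex set set set \<Rightarrow>
      vertex set set set \<Rightarrow> point set"
    by blast
  from this[of "\<lambda>v v' m f f'. {Vertex v, Vertex v', Factorization f, Factorization f'} \<union>
      Bisection ` (bisections - (same_triangle v v' \<union> matching_bisections m))"]
  have "edge_matching_blocks =
      \<Union> {?P f f' | f f'. f \<in> one_factorizations \<and> f' \<in> one_factorizations \<and> f \<noteq> f'}"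
    unfolding edge_matching_blocks_def .
  also have "\<dots> = \<Union> {?Q i j | i j. i < 6 \<and> j < 6 \<and> i \<noteq> j}"
    unfolding factorization_pairs by (rule arg_cong[of _ _ Union, OF Collect_pairs_cong[OF PQ]])
  also have "\<dots> = \<Union> ((\<lambda>(i, j). ?Q i j) ` set index_pairs)"
    using sym by (intro arg_cong[of _ _ Union] symmetric_pairs_image index_pairs_iff)
  finally show ?thesis
    by (simp add: image_Union image_image case_prod_unfold
        del: edge_shared_matching_blocks.simps)
qed

lemma blocks_eq:
  "edge_blocks \<union> matching_blocks \<union> edge_matching_blocks = (`) decode ` set label_blocks"
proof -
  have "set label_blocks = ({V ` set vertices} \<union> edge_block ` set vertex_pairs) \<union>
      ({W ` set [0..<6]} \<union> matching_block ` set index_pairs) \<union>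
      (\<Union>p\<in>set index_pairs. set (edge_shared_matching_blocks p))"
    unfolding label_blocks_def by auto
  then show ?thesis
    unfolding edge_blocks_eq matching_blocks_eq edge_matching_blocks_eq
    by (simp only: image_Un)
qed

section \<open>Check of all 1540 triples of labels and transfer to the points\<close>

lemma label_blocks_cover: "unique_cover 3 label_blocks labels"
  by code_simp

lemma label_blocks_card: "\<forall>b\<in>set label_blocks. b \<subseteq> set labels \<and> card b = 6"
  by code_simp

lemma card_labels: "card (set labels) = 22"
  by code_simp

theorem mainTheorem1:
  "is_design 3 22 6 1 points (edge_blocks \<union> matching_blocks \<union> edge_matching_blocks)"
  unfolding is_design_def points_eq blocks_eq
proof (intro conjI ballI allI impI)
  show "finite (decode ` set labels)" by simp
  show "card (decode ` set labels) = 22"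
    using card_labels by (simp add: card_image[OF inj_on_decode])
next
  fix b
  assume "b \<in> (`) decode ` set label_blocks"
  then obtain b' where b: "b = decode ` b'" "b' \<subseteq> set labels" "card b' = 6"
    using label_blocks_card by blast
  then show "b \<subseteq> decode ` set labels" "card b = 6"
    using card_image[OF inj_on_subset[OF inj_on_decode b(2)]] by auto
next
  fix S
  assume "S \<subseteq> decode ` set labels \<and> card S = 3"
  then obtain S' where S': "S' \<subseteq> set labels" "S = decode ` S'" "card S' = 3"
    using card_image[OF inj_on_subset[OF inj_on_decode]] by (metis subset_image_iff)
  have sub: "b \<subseteq> set labels" if "b \<in> set label_blocks" for b
    using that label_blocks_card by blast
  \<comment> \<open>Both \<open>S'\<close> and \<open>b\<close> lie in \<open>labels\<close>, where
    \<open>decode\<close> is injective and therefore reflects inclusion.\<close>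
  have "S \<subseteq> decode ` b \<longleftrightarrow> S' \<subseteq> b" if "b \<in> set label_blocks" for b
    using inj_on_image_mem_iff[OF inj_on_decode _ sub[OF that]] S'(1)
    unfolding S'(2) image_subset_iff subset_iff by blast
  then have "{b \<in> (`) decode ` set label_blocks. S \<subseteq> b} =
      (`) decode ` {b \<in> set label_blocks. S' \<subseteq> b}"
    by auto
  \<comment> \<open>Distinct blocks of labels have distinct images, so the count of blocks through
    \<open>S'\<close> is also the count through \<open>S\<close>.\<close>
  moreover have "inj_on ((`) decode) {b \<in> set label_blocks. S' \<subseteq> b}"
    using inj_on_image_eq_iff[OF inj_on_decode sub sub] by (auto simp: inj_on_def)
  ultimately show "card {b \<in> (`) decode ` set label_blocks. S \<subseteq> b} = 1"
    using unique_coverD[OF label_blocks_cover S'(1,3)] by (simp add: card_image)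
qed

end
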